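(* Let $\pi, w \in S_n$ be permutations with $Q(\pi)=Q(w)$, where $Q$ denotes the Robinson--Schensted recording tableau. Then, at every $t \ge 0$, (1) the positions of the nonempty boxes in $\mathrm{BB}^t(\pi)$ and $\mathrm{BB}^t(w)$ are equal; (2) $\mathrm{sh}\,\mathrm{ID}(\mathrm{BB}^t(\pi)) = \mathrm{sh}\,\mathrm{ID}(\mathrm{BB}^t(w))$, and the gaps between the increasing runs are the same. Equivalently, the configuration arrays $\mathrm{CA}(\mathrm{BB}^t(\pi))$ and $\mathrm{CA}(\mathrm{BB}^t(w))$ are of identical shape for each $t$.
   Context: Box-ball system (BBS). Boxes are indexed by $\mathbb{Z}$ from left to right. A BBS configuration (with $n$ balls) is a sequence $X$ indexed by $\mathbb{Z}$ in which each of $1,\dots,n$ (the balls) appears exactly once and every other entry is $e := n+1$ (an empty box). One BBS move transforms $X$ into $\mathrm{BB}(X)$: the balls $1,2,\dots,n$, in this order, each jump once, to the nearest box to the right of the ball that is empty at that moment (the box a ball leaves becomes empty). $\mathrm{BB}^t(X)$ is the result of $t$ BBS moves. A permutation $w = w_1\cdots w_n \in S_n$ (one-line notation) is regarded as the configuration with ball $w_i$ in box $i$ for $1\le i\le n$ and all other boxes empty. An increasing run of a configuration is a maximal contiguous (occupying consecutive boxes) increasing nonempty sequence of balls. The increasing run decomposition $\mathrm{ID}(X)$ is the table whose first (top) row is the rightmost increasing run of $X$, whose second row is the next increasing run to its left, and so on; $\mathrm{sh}\,\mathrm{ID}(X)$ is its shape, i.e. the sequence of its row lengths. The gap between two neighboring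 increasing runs is the number of empty boxes between them. The configuration array $\mathrm{CA}(X)$ has the same rows in the same order (top row is the rightmost run), positioned horizontally as follows: if there are $g \ge 0$ empty boxes between an increasing run and the next increasing run to its left, then the row of the latter, placed directly below, starts $g$ columns to the left of the start of the row above it. *)

theory Defs
  imports "HOL-Combinatorics.Permutations" "HOL-Library.Product_Lexorder"
begin

section \<open>Box-ball system\<close>

abbreviation empty_box :: "nat \<Rightarrow> nat" where
  "empty_box n \<equiv> n + 1"

definition is_config :: "nat \<Rightarrow> (int \<Rightarrow> nat) \<Rightarrow> bool" where
  "is_config n X \<longleftrightarrow>
     (\<forall>i\<in>{1..n}. \<exists>!k. X k = i) \<and> (\<forall>k. X k \<notin> {1..n} \<longrightarrow> X k = empty_box n)"

text \<open>The operations below are meant for functions satisfying \<^const>\<open>is_config\<close>; there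
  the \<open>THE\<close> and the \<open>LEAST\<close> are well defined, since only finitely many boxes are nonempty.\<close>

definition jump :: "nat \<Rightarrow> nat \<Rightarrow> (int \<Rightarrow> nat) \<Rightarrow> (int \<Rightarrow> nat)" where
  "jump n i X =
     (let p = (THE k. X k = i);
          q = (LEAST k. p < k \<and> X k = empty_box n)
      in X(p := empty_box n, q := i))"

definition BB :: "nat \<Rightarrow> (int \<Rightarrow> nat) \<Rightarrow> (int \<Rightarrow> nat)" where
  "BB n X = fold (jump n) [1..<n+1] X"

definition perm_config :: "nat \<Rightarrow> (nat \<Rightarrow> nat) \<Rightarrow> (int \<Rightarrow> nat)" where
  "perm_config n w = (\<lambda>k. if 1 \<le> k \<and> k \<le> int n then w (nat k) else empty_box n)"

definition nonempty_boxes :: "nat \<Rightarrow> (int \<Rightarrow> nat) \<Rightarrow> int set" where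
  "nonempty_boxes n X = {k. X k \<noteq> empty_box n}"

lemma is_config_perm_config:
  assumes "w permutes {1..n}"
  shows "is_config n (perm_config n w)"
  unfolding is_config_def
proof (intro conjI ballI allI impI)
  fix i assume i: "i \<in> {1..n}"
  show "\<exists>!k. perm_config n w k = i"
  proof (rule ex1I)
    have "inv w i \<in> {1..n}" "w (inv w i) = i"
      using i assms by (simp_all only: permutes_in_image[OF permutes_inv] permutes_inverses)
    then show "perm_config n w (int (inv w i)) = i"
      by (auto simp: perm_config_def)
  next
    fix k assume "perm_config n w k = i"
    then have "w (nat k) = i" "1 \<le> k"
      using i by (auto simp: perm_config_def split: if_splits)
    then show "k = int (inv w i)"
      using permutes_inverses(2)[OF assms, of "nat k"] by auto
  qed
next
  fix k assume "perm_config n w k \<notin> {1..n}"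
  then show "perm_config n w k = empty_box n"
    using permutes_in_image[OF assms, of "nat k"]
    by (auto simp: perm_config_def split: if_splits)
qed


section \<open>Increasing runs and the configuration array\<close>

text \<open>A contiguous increasing sequence of balls is represented by the pair of its first and
  its last box. The order on these pairs is the lexicographic one; distinct increasing runs
  are disjoint, so it orders them from left to right.\<close>

definition increasing_block :: "nat \<Rightarrow> (int \<Rightarrow> nat) \<Rightarrow> int \<Rightarrow> int \<Rightarrow> bool" where
  "increasing_block n X a b \<longleftrightarrow>
     a \<le> b \<and> (\<forall>k\<in>{a..b}. X k \<noteq> empty_box n) \<and> strict_mono_on {a..b} X"

definition increasing_run :: "nat \<Rightarrow> (int \<Rightarrow> nat) \<Rightarrow> int \<Rightarrow> int \<Rightarrow> bool" where
  "increasing_run n X a b \<longleftrightarrow>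
     increasing_block n X a b \<and>
     (\<forall>a' b'. increasing_block n X a' b' \<and> {a..b} \<subseteq> {a'..b'} \<longrightarrow> a' = a \<and> b' = b)"

definition runs :: "nat \<Rightarrow> (int \<Rightarrow> nat) \<Rightarrow> (int \<times> int) list" where
  "runs n X = rev (sorted_list_of_set {(a, b). increasing_run n X a b})"

definition ID :: "nat \<Rightarrow> (int \<Rightarrow> nat) \<Rightarrow> nat list list" where
  "ID n X = map (\<lambda>(a, b). map X [a..b]) (runs n X)"

definition sh :: "nat list list \<Rightarrow> nat list" where
  "sh T = map length T"

text \<open>The \<open>i\<close>-th gap is the one between the \<open>i\<close>-th run and its left neighbour, counting runs
  from the right, starting with \<open>0\<close>.\<close>

definition gaps :: "nat \<Rightarrow> (int \<Rightarrow> nat) \<Rightarrow> nat list" where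
  "gaps n X =
     map (\<lambda>i. card {k. snd (runs n X ! Suc i) < k \<and> k < fst (runs n X ! i) \<and> X k = empty_box n})
       [0..<length (runs n X) - 1]"

text \<open>The configuration array is a partial filling of the cells \<open>(row, column)\<close>, with rows
  numbered \<open>0, 1, \<dots>\<close> from the top. Its horizontal position is fixed by letting the top row
  start in column \<open>0\<close>; its shape is its set of filled cells.\<close>

definition CA_start :: "nat \<Rightarrow> (int \<Rightarrow> nat) \<Rightarrow> nat \<Rightarrow> int" where
  "CA_start n X i = - (\<Sum>j<i. int (gaps n X ! j))"

definition CA :: "nat \<Rightarrow> (int \<Rightarrow> nat) \<Rightarrow> (nat \<times> int \<Rightarrow> nat option)" where
  "CA n X = (\<lambda>(i, c).
     if i < length (ID n X) \<and> CA_start n X i \<le> c \<and> c < CA_start n X i + int (length (ID n X ! i))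
     then Some (ID n X ! i ! nat (c - CA_start n X i))
     else None)"

definition CA_shape :: "(nat \<times> int \<Rightarrow> nat option) \<Rightarrow> (nat \<times> int) set" where
  "CA_shape A = dom A"


section \<open>Robinson--Schensted correspondence\<close>

text \<open>Row insertion into an increasing row: the leftmost entry greater than \<open>x\<close>, if any, is
  replaced by \<open>x\<close> and returned; otherwise \<open>x\<close> is appended.\<close>

fun row_insert :: "nat \<Rightarrow> nat list \<Rightarrow> nat list \<times> nat option" where
  "row_insert x [] = ([x], None)"
| "row_insert x (y # ys) =
     (if x < y then (x # ys, Some y)
      else (case row_insert x ys of (zs, b) \<Rightarrow> (y # zs, b)))"

text \<open>Schensted insertion into a tableau (a list of rows, top row first); the second component
  of the result is the index of the row that has received a new cell.\<close>

fun schensted_insert :: "nat \<Rightarrow> nat list list \<Rightarrow> nat list list \<times> nat" where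
  "schensted_insert x [] = ([[x]], 0)"
| "schensted_insert x (r # rs) =
     (case row_insert x r of
        (r', None) \<Rightarrow> (r' # rs, 0)
      | (r', Some y) \<Rightarrow> (case schensted_insert y rs of (rs', k) \<Rightarrow> (r' # rs', Suc k)))"

definition add_cell :: "nat \<Rightarrow> nat \<Rightarrow> nat list list \<Rightarrow> nat list list" where
  "add_cell k i T = (if k < length T then T[k := T ! k @ [i]] else T @ [[i]])"

fun RS_aux :: "nat \<Rightarrow> nat list \<Rightarrow> nat list list \<times> nat list list \<Rightarrow> nat list list \<times> nat list list" where
  "RS_aux i [] (P, Q) = (P, Q)"
| "RS_aux i (x # xs) (P, Q) =
     (case schensted_insert x P of (P', k) \<Rightarrow> RS_aux (Suc i) xs (P', add_cell k i Q))"

definition RS :: "nat list \<Rightarrow> nat list list \<times> nat list list" where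
  "RS xs = RS_aux 1 xs ([], [])"

definition recording_tableau :: "nat \<Rightarrow> (nat \<Rightarrow> nat) \<Rightarrow> nat list list" where
  "recording_tableau n w = snd (RS (map w [1..<n+1]))"

end

theory Submission
  imports Defs
begin

text \<open>A configuration \<open>X\<close> is encoded by its position word, the list of the boxes of the balls
  \<open>1, \<dots>, n\<close> in this order. The proof shows that, for the two evolving configurations, these
  words stay Knuth equivalent.

  Knuth equivalence of the position words forces everything that is claimed. Equivalent words
  have the same letters, so the nonempty boxes agree. Moreover a Knuth move never exchanges
  \<open>k\<close> and \<open>k + 1\<close>, so it preserves which of two neighboring boxes carries the smaller ball;
  hence the increasing runs occupy the same boxes, which fixes the run lengths, the gaps and
  the shape of the configuration array.

  Initially, the position word of a permutation \<open>w\<close> is its inverse, and by the symmetry of the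
  Robinson--Schensted correspondence the insertion tableau of the inverse is \<open>Q(w)\<close>. As a word is
  Knuth equivalent to the reading word of its insertion tableau, the position word depends up
  to equivalence on \<open>Q(w)\<close> only (\<open>inv_word_knuth_recording_tableau\<close>). The symmetry is proved
  row by row and by induction on the time: extending \<open>w\<close> by one letter inserts a new largest
  letter into the inverse word, and the two descriptions of the new tableau agree
  (\<open>tableaux_of_insert\<close>).

  During a move, the ball in box \<open>p\<close> exchanges \<open>p\<close> with the smallest empty box greater than
  \<open>p\<close>. This is row insertion of \<open>p\<close> into the increasing sequence of empty boxes. A box-ball move
  thus inserts the position word letter by letter into that row, and the word of bumped letters
  is the position word of the new configuration (\<open>position_word_BB\<close>). Row insertion turns Knuth
  equivalent words into Knuth equivalent words of bumped letters (\<open>land_knuth_equiv\<close>), and the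
  rows inserted into are the same for the two configurations because their nonempty boxes are.\<close>

section \<open>Knuth equivalence\<close>

inductive knuth_equiv :: "'a::linorder list \<Rightarrow> 'a list \<Rightarrow> bool" (infix \<open>\<approx>\<close> 50) where
  refl: "u \<approx> u"
| sym: "u \<approx> v \<Longrightarrow> v \<approx> u"
| trans: "u \<approx> v \<Longrightarrow> v \<approx> w \<Longrightarrow> u \<approx> w"
| yzx: "x < y \<Longrightarrow> y < z \<Longrightarrow> a @ [y, z, x] @ b \<approx> a @ [y, x, z] @ b"
| xzy: "x < y \<Longrightarrow> y < z \<Longrightarrow> a @ [x, z, y] @ b \<approx> a @ [z, x, y] @ b"

declare knuth_equiv.trans [trans]

lemma knuth_equiv_context: "u \<approx> v \<Longrightarrow> a @ u @ b \<approx> a @ v @ b"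
proof (induction rule: knuth_equiv.induct)
  case (yzx x y z a' b')
  then show ?case using knuth_equiv.yzx[of x y z "a @ a'" "b' @ b"] by simp
next
  case (xzy x y z a' b')
  then show ?case using knuth_equiv.xzy[of x y z "a @ a'" "b' @ b"] by simp
qed (auto intro: knuth_equiv.intros)

lemma knuth_equiv_Cons: "u \<approx> v \<Longrightarrow> a # u \<approx> a # v"
  using knuth_equiv_context[of u v "[a]" "[]"] by simp

lemma knuth_equiv_append: "u \<approx> v \<Longrightarrow> u @ b \<approx> v @ b"
  using knuth_equiv_context[of u v "[]" b] by simp

lemma knuth_equiv_map:
  assumes "strict_mono f"
  shows "u \<approx> v \<Longrightarrow> map f u \<approx> map f v"
proof (induction rule: knuth_equiv.induct)
  case (yzx x y z a b)
  then show ?case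
    using knuth_equiv.yzx[of "f x" "f y" "f z" "map f a" "map f b"] assms
    by (simp add: strict_mono_less)
next
  case (xzy x y z a b)
  then show ?case
    using knuth_equiv.xzy[of "f x" "f y" "f z" "map f a" "map f b"] assms
    by (simp add: strict_mono_less)
qed (auto intro: knuth_equiv.intros)

lemma knuth_equiv_mset: "u \<approx> v \<Longrightarrow> mset u = mset v"
  by (induction rule: knuth_equiv.induct) auto

lemma knuth_equiv_set: "u \<approx> v \<Longrightarrow> set u = set v"
  using knuth_equiv_mset mset_eq_setD by blast

lemma knuth_equiv_distinct: "u \<approx> v \<Longrightarrow> distinct u \<longleftrightarrow> distinct v"
  using knuth_equiv_mset mset_eq_imp_distinct_iff by blast

text \<open>A Knuth move exchanges two letters between which a third one lies in value, so it
  never exchanges consecutive integers.\<close>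

lemma knuth_equiv_filter_consecutive:
  fixes k :: int
  shows "u \<approx> v \<Longrightarrow>
    filter (\<lambda>j. j = k \<or> j = k + 1) u = filter (\<lambda>j. j = k \<or> j = k + 1) v"
  by (induction rule: knuth_equiv.induct) auto


section \<open>Row insertion and Knuth equivalence\<close>

lemma row_insert_None:
  "row_insert x r = (r', None) \<Longrightarrow> r' = r @ [x] \<and> (\<forall>a\<in>set r. a \<le> x)"
  by (induction r arbitrary: r') (auto split: if_splits prod.splits)

lemma row_insert_Some:
  "row_insert x r = (r', Some y) \<Longrightarrow>
    \<exists>r1 r2. r = r1 @ y # r2 \<and> r' = r1 @ x # r2 \<and> (\<forall>a\<in>set r1. a \<le> x) \<and> x < y"
proof (induction r arbitrary: r')
  case (Cons a r)
  show ?case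
  proof (cases "x < a")
    case True
    with Cons.prems show ?thesis by (intro exI[of _ "[]"] exI[of _ r]) auto
  next
    case False
    with Cons.prems obtain s where s: "row_insert x r = (s, Some y)" "r' = a # s"
      by (auto split: prod.splits)
    from Cons.IH[OF s(1)] obtain r1 r2 where
      "r = r1 @ y # r2" "s = r1 @ x # r2" "\<forall>a\<in>set r1. a \<le> x" "x < y"
      by blast
    with s False show ?thesis
      by (intro exI[of _ "a # r1"] exI[of _ r2]) auto
  qed
qed simp

lemma row_insert_snoc:
  "row_insert x (r @ [m]) =
     (case row_insert x r of
        (r', None) \<Rightarrow> (if x < m then (r @ [x], Some m) else (r @ [m, x], None))
      | (r', Some y) \<Rightarrow> (r' @ [m], Some y))"
  by (induction r) (auto split: prod.splits option.splits)

lemma row_insert_between: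
  assumes "\<forall>c\<in>set r. c < a" and "\<forall>c\<in>set s. a < c"
  shows "row_insert a (r @ s) =
    (case s of [] \<Rightarrow> (r @ [a], None) | b # s' \<Rightarrow> (r @ a # s', Some b))"
  using assms by (induction r) (auto split: list.splits)

lemma knuth_equiv_move_left:
  assumes "x < a" and "sorted_wrt (<) (a # r)"
  shows "a # r @ [x] \<approx> a # x # r"
  using assms(2)
proof (induction r rule: rev_induct)
  case (snoc d r)
  define c where "c = last (a # r)"
  have c: "a # r = butlast (a # r) @ [c]"
    unfolding c_def by (metis append_butlast_last_id list.distinct(1))
  have "c \<in> set (a # r)" by (simp add: c_def)
  then have "x < c" "c < d"
    using snoc.prems assms(1) by (auto simp: sorted_wrt_append)
  then have "butlast (a # r) @ [c, d, x] @ [] \<approx> butlast (a # r) @ [c, x, d] @ []"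
    by (rule knuth_equiv.yzx)
  moreover have "butlast (a # r) @ [c, d, x] @ [] = a # (r @ [d]) @ [x]"
    using c by (metis append.assoc append_Cons append_Nil append_Nil2)
  moreover have "butlast (a # r) @ [c, x, d] @ [] = (a # r @ [x]) @ [d]"
    using c by (metis append.assoc append_Cons append_Nil append_Nil2)
  ultimately have "a # (r @ [d]) @ [x] \<approx> (a # r @ [x]) @ [d]"
    by (simp only:)
  also have "(a # r @ [x]) @ [d] \<approx> (a # x # r) @ [d]"
    using snoc by (intro knuth_equiv_append) (auto simp: sorted_wrt_append)
  finally show ?case by simp
qed (simp add: knuth_equiv.refl)

text \<open>The inserted letter moves left through the larger entries until it meets the entry that
  it bumps; that entry then moves left through the smaller ones, to the front of the row.\<close>

lemma row_insert_knuth_equiv: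
  "row_insert x r = (r', Some y) \<Longrightarrow> sorted_wrt (<) r \<Longrightarrow> x \<notin> set r \<Longrightarrow>
    r @ [x] \<approx> y # r'"
proof (induction r arbitrary: r')
  case (Cons a r)
  show ?case
  proof (cases "x < a")
    case True
    with Cons.prems show ?thesis using knuth_equiv_move_left[of x a r] by auto
  next
    case False
    with Cons.prems obtain s where s: "row_insert x r = (s, Some y)" "r' = a # s"
      by (auto split: prod.splits)
    from row_insert_Some[OF s(1)] obtain r1 r2 where
      r: "r = r1 @ y # r2" "s = r1 @ x # r2" "x < y"
      by blast
    have "s \<noteq> []" using r(2) by simp
    then obtain h t where h: "s = h # t" by (auto simp: neq_Nil_conv)
    have "h \<in> insert x (set r)" "h < y" "h = x \<or> h \<in> set r"
      using h r Cons.prems by (cases r1; auto simp: sorted_wrt_append)+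
    moreover have "a < x" using False Cons.prems by auto
    ultimately have "a < h" "h < y" using Cons.prems by auto
    then have "[] @ [a, y, h] @ t \<approx> [] @ [y, a, h] @ t"
      by (rule knuth_equiv.xzy)
    then have "a # y # s \<approx> y # r'" using h s by simp
    moreover have "a # r @ [x] \<approx> a # y # s"
      using Cons.IH[OF s(1)] Cons.prems by (intro knuth_equiv_Cons) auto
    ultimately show ?thesis by (auto intro: knuth_equiv.trans)
  qed
qed simp


section \<open>The recording tableau and the inverse permutation\<close>

text \<open>Inserts into a row the second components of a list of pairs. A pair whose letter is
  appended contributes its first component to the second result; a pair whose letter bumps
  contributes the bumped letter, paired with the same first component, to the third.\<close>

fun bump_word ::
  "nat list \<Rightarrow> (nat \<times> nat) list \<Rightarrow> nat list \<times> nat list \<times> (nat \<times> nat) list" where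
  "bump_word R [] = (R, [], [])"
| "bump_word R ((v, x) # p) =
     (case row_insert x R of
        (R', None) \<Rightarrow> (case bump_word R' p of (F, A, B) \<Rightarrow> (F, v # A, B))
      | (R', Some y) \<Rightarrow> (case bump_word R' p of (F, A, B) \<Rightarrow> (F, A, (v, y) # B)))"

lemma bump_word_cases:
  assumes "bump_word R ((v, x) # p) = (F, A, B)"
  obtains
    (Append) A' where "row_insert x R = (R @ [x], None)" "\<forall>a\<in>set R. a \<le> x"
      "bump_word (R @ [x]) p = (F, A', B)" "A = v # A'"
  | (Bump) r1 y r2 B' where "row_insert x R = (r1 @ x # r2, Some y)" "R = r1 @ y # r2"
      "\<forall>a\<in>set r1. a \<le> x" "x < y" "bump_word (r1 @ x # r2) p = (F, A, B')" "B = (v, y) # B'"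
proof (cases "row_insert x R")
  case (Pair R' b)
  show thesis
  proof (cases b)
    case None
    with Pair row_insert_None[of x R R'] assms that(1) show thesis
      by (auto split: prod.splits)
  next
    case (Some y)
    with Pair row_insert_Some[of x R R' y] assms that(2) show thesis
      by (fastforce split: prod.splits)
  qed
qed

lemma bump_word_append:
  "bump_word R p = (F, A, B) \<Longrightarrow> bump_word F q = (F', A', B') \<Longrightarrow>
    bump_word R (p @ q) = (F', A @ A', B @ B')"
proof (induction p arbitrary: R A B)
  case (Cons vx p)
  obtain v x where vx: "vx = (v, x)" by fastforce
  from Cons.prems(1)[unfolded vx] show ?case
  proof (cases rule: bump_word_cases)
    case (Append A0)
    with Cons.IH[OF Append(3) Cons.prems(2)] show ?thesis by (simp add: vx)
  next
    case (Bump r1 y r2 B0)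
    with Cons.IH[OF Bump(5) Cons.prems(2)] show ?thesis by (simp add: vx)
  qed
qed simp

lemma bump_word_sets:
  "bump_word R p = (F, A, B) \<Longrightarrow>
    set A \<subseteq> fst ` set p \<and> fst ` set B \<subseteq> fst ` set p \<and>
    set F \<subseteq> set R \<union> snd ` set p \<and> snd ` set B \<subseteq> set R \<union> snd ` set p"
proof (induction p arbitrary: R A B)
  case (Cons vx p)
  obtain v x where vx: "vx = (v, x)" by fastforce
  from Cons.prems(1)[unfolded vx] show ?case
  proof (cases rule: bump_word_cases)
    case (Append A0)
    with Cons.IH[OF Append(3)] show ?thesis by (auto simp: vx)
  next
    case (Bump r1 y r2 B0)
    with Cons.IH[OF Bump(5)] show ?thesis by (auto simp: vx)
  qed
qed simp

lemma bump_word_sorted_fst: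
  "bump_word R p = (F, A, B) \<Longrightarrow> sorted_wrt (<) (map fst p) \<Longrightarrow> sorted_wrt (<) (map fst B)"
proof (induction p arbitrary: R A B)
  case (Cons vx p)
  obtain v x where vx: "vx = (v, x)" by fastforce
  from Cons.prems(1)[unfolded vx] show ?case
  proof (cases rule: bump_word_cases)
    case (Append A0)
    with Cons.IH[OF Append(3)] Cons.prems(2) show ?thesis by (auto simp: vx)
  next
    case (Bump r1 y r2 B0)
    have "\<forall>u\<in>fst ` set p. v < u" using Cons.prems(2) by (simp add: vx)
    then have "\<forall>u\<in>fst ` set B0. v < u" using bump_word_sets[OF Bump(5)] by blast
    with Cons.IH[OF Bump(5)] Cons.prems(2) Bump(6) show ?thesis by (simp add: vx)
  qed
qed simp

text \<open>A letter \<open>m\<close> larger than all others stays at the end of the row and changes nothing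
  until another letter would be appended; that letter bumps \<open>m\<close> instead.\<close>

lemma bump_word_snoc_max:
  assumes "bump_word R p = (F, A, B)" and "sorted_wrt (<) (map fst p)"
    and "\<forall>x\<in>set R \<union> snd ` set p. x < m"
  shows "(A = [] \<and> bump_word (R @ [m]) p = (F @ [m], [], B)) \<or>
    (\<exists>b A' B1 B2. A = b # A' \<and> B = B1 @ B2 \<and>
       (\<forall>v\<in>fst ` set B1. v < b) \<and> (\<forall>v\<in>fst ` set B2. b < v) \<and>
       bump_word (R @ [m]) p = (F, A', B1 @ (b, m) # B2))"
  using assms
proof (induction p arbitrary: R A B)
  case (Cons vx p)
  obtain v x where vx: "vx = (v, x)" by fastforce
  from Cons.prems(1)[unfolded vx] show ?case
  proof (cases rule: bump_word_cases)
    case (Append A0)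
    have "bump_word (R @ [m]) (vx # p) = (F, A0, [] @ (v, m) # B)"
      using Append Cons.prems(3) by (simp add: vx row_insert_snoc)
    moreover have "\<forall>u\<in>fst ` set p. v < u" using Cons.prems(2) by (simp add: vx)
    then have "\<forall>u\<in>fst ` set B. v < u" using bump_word_sets[OF Append(3)] by blast
    ultimately show ?thesis using Append(4) by fastforce
  next
    case (Bump r1 y r2 B0)
    let ?R = "r1 @ x # r2"
    have bump: "bump_word (R @ [m]) (vx # p) =
        (case bump_word (?R @ [m]) p of (F, A, B) \<Rightarrow> (F, A, (v, y) # B))"
      using Bump(1) by (simp add: vx row_insert_snoc)
    have "\<forall>z\<in>set ?R \<union> snd ` set p. z < m"
      using Cons.prems(3) Bump(2) by (auto simp: vx)
    with Cons.IH[OF Bump(5)] Cons.prems(2) consider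
      "A = []" "bump_word (?R @ [m]) p = (F @ [m], [], B0)"
    | b A' B1 B2 where "A = b # A'" "B0 = B1 @ B2" "\<forall>v\<in>fst ` set B1. v < b"
        "\<forall>v\<in>fst ` set B2. b < v" "bump_word (?R @ [m]) p = (F, A', B1 @ (b, m) # B2)"
      by auto
    then show ?thesis
    proof cases
      case 1
      with bump Bump(6) show ?thesis by simp
    next
      case 2
      have "\<forall>u\<in>fst ` set p. v < u" using Cons.prems(2) by (simp add: vx)
      moreover have "b \<in> fst ` set p" using bump_word_sets[OF Bump(5)] 2(1) by auto
      ultimately have "v < b" by blast
      with 2 bump Bump(6) show ?thesis
        by (intro disjI2 exI[of _ b] exI[of _ A'] exI[of _ "(v, y) # B1"] exI[of _ B2]) auto
    qed
  qed
qed simp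

text \<open>Each bumped letter moves to the front of the row and joins the letters bumped before it.\<close>

lemma bump_word_knuth_equiv:
  "bump_word R p = (F, A, B) \<Longrightarrow> sorted_wrt (<) R \<Longrightarrow> distinct (R @ map snd p) \<Longrightarrow>
    R @ map snd p \<approx> map snd B @ F"
proof (induction p arbitrary: R A B)
  case Nil
  then show ?case by (simp add: knuth_equiv.refl)
next
  case (Cons vx p)
  obtain v x where vx: "vx = (v, x)" by fastforce
  from Cons.prems(1)[unfolded vx] show ?case
  proof (cases rule: bump_word_cases)
    case (Append A0)
    have "x \<notin> set R" using Cons.prems(3) by (auto simp: vx)
    with Append(2) have "\<forall>a\<in>set R. a < x" by (metis order_less_le)
    with Cons.prems(2) have "sorted_wrt (<) (R @ [x])" by (simp add: sorted_wrt_append)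
    with Cons.IH[OF Append(3)] Cons.prems(3) show ?thesis by (simp add: vx)
  next
    case (Bump r1 y r2 B0)
    have "x \<notin> set R" using Cons.prems(3) by (auto simp: vx)
    then have "x \<notin> set r1" using Bump(2) by simp
    with Bump(3) have "\<forall>a\<in>set r1. a < x" by (metis order_less_le)
    moreover have "\<forall>a\<in>set r2. x < a"
      using Cons.prems(2) Bump(2,4) by (auto simp: sorted_wrt_append)
    ultimately have "sorted_wrt (<) (r1 @ x # r2)"
      using Cons.prems(2) Bump(2) by (simp add: sorted_wrt_append)
    with Cons.IH[OF Bump(5)] Bump(2) Cons.prems(3)
    have "(r1 @ x # r2) @ map snd p \<approx> map snd B0 @ F"
      by (auto simp: vx)
    then have "y # (r1 @ x # r2) @ map snd p \<approx> map snd B @ F"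
      using Bump(6) by (simp add: knuth_equiv_Cons)
    moreover have "(R @ [x]) @ map snd p \<approx> (y # (r1 @ x # r2)) @ map snd p"
      using row_insert_knuth_equiv[OF Bump(1) Cons.prems(2) \<open>x \<notin> set R\<close>]
      by (rule knuth_equiv_append)
    ultimately have "(R @ [x]) @ map snd p \<approx> map snd B @ F"
      using knuth_equiv.trans by auto
    then show ?thesis by (simp add: vx)
  qed
qed

text \<open>For a list of pairs ordered by first components, \<open>Q\<close> is the insertion tableau of the
  second components, built one row at a time, and \<open>P\<close> its recording tableau, with the first
  components in the role of the insertion times.\<close>

inductive tableaux_of :: "(nat \<times> nat) list \<Rightarrow> nat list list \<Rightarrow> nat list list \<Rightarrow> bool" where
  Nil: "tableaux_of [] [] []"
| Row: "p \<noteq> [] \<Longrightarrow> bump_word [] p = (R, A, B) \<Longrightarrow> tableaux_of B P Q \<Longrightarrow>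
    tableaux_of p (A # P) (R # Q)"

lemma tableaux_of_knuth_equiv:
  "tableaux_of p P Q \<Longrightarrow> distinct (map snd p) \<Longrightarrow> map snd p \<approx> concat (rev Q)"
proof (induction rule: tableaux_of.induct)
  case (Row p R A B P Q)
  have *: "map snd p \<approx> map snd B @ R"
    using bump_word_knuth_equiv[OF Row.hyps(2)] Row.prems by simp
  with Row.prems have "distinct (map snd B)"
    using knuth_equiv_distinct[OF *] by simp
  then have "map snd B @ R \<approx> concat (rev Q) @ R"
    by (intro knuth_equiv_append Row.IH)
  with * have "map snd p \<approx> concat (rev Q) @ R" by (rule knuth_equiv.trans)
  then show ?case by simp
qed (simp add: knuth_equiv.refl)

text \<open>The key to the symmetry of the Robinson--Schensted correspondence: adding the point
  \<open>(a, m)\<close> to a permutation matrix, at the latest time \<open>m\<close>, is one Schensted insertion of \<open>a\<close>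
  when the matrix is read by time, and the insertion of a new largest letter \<open>m\<close> into a word
  when it is read by value. For the first row, \<open>A\<close> lists the values whose letters were appended.
  If \<open>A\<close> has entries above \<open>a\<close>, let \<open>b\<close> be the smallest: inserting \<open>a\<close> into \<open>A\<close> bumps \<open>b\<close>, and
  \<open>m\<close>, appended at the value \<open>a\<close>, is bumped at the value \<open>b\<close>. So \<open>a\<close> replaces \<open>b\<close> in \<open>A\<close>, and the
  point \<open>(b, m)\<close> goes on to the second row. Otherwise \<open>a\<close> and \<open>m\<close> both stay in the first row.\<close>

lemma tableaux_of_insert:
  assumes "tableaux_of p P Q" and "p = p1 @ p2" and "sorted_wrt (<) (map fst p)"
    and "\<forall>v\<in>fst ` set p1. v < a" and "\<forall>v\<in>fst ` set p2. a < v"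
    and "\<forall>x\<in>snd ` set p. x < m" and "schensted_insert a P = (P', k)"
  shows "tableaux_of (p1 @ (a, m) # p2) P' (add_cell k m Q)"
  using assms
proof (induction arbitrary: p1 p2 a P' k rule: tableaux_of.induct)
  case Nil
  have "tableaux_of [(a, m)] [[a]] [[m]]"
    by (rule tableaux_of.Row[where B = "[]"]) (simp_all add: tableaux_of.Nil)
  with Nil show ?case by (simp add: add_cell_def)
next
  case (Row p R A B P Q)
  obtain R1 A1 B1 where 1: "bump_word [] p1 = (R1, A1, B1)" by (rule prod_cases3)
  obtain R2 A2 B2 where 2: "bump_word R1 p2 = (R2, A2, B2)" by (rule prod_cases3)
  have RAB: "R = R2" "A = A1 @ A2" "B = B1 @ B2"
    using bump_word_append[OF 1 2] Row.hyps(2) Row.prems(1) by auto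
  have sets: "set A1 \<subseteq> fst ` set p1" "fst ` set B1 \<subseteq> fst ` set p1" "set R1 \<subseteq> snd ` set p1"
      "set A2 \<subseteq> fst ` set p2"
    using bump_word_sets[OF 1] bump_word_sets[OF 2] by simp_all
  have A: "\<forall>c\<in>set A1. c < a" "\<forall>c\<in>set A2. a < c"
    using Row.prems(3,4) by (blast dest: subsetD[OF sets(1)] subsetD[OF sets(4)])+
  have lt: "\<forall>x\<in>set R1. x < m"
    using subsetD[OF sets(3)] Row.prems(1,5) by auto
  have "row_insert m R1 = (R1 @ [m], None)"
    using row_insert_between[of R1 m "[]"] lt by simp
  then have new: "bump_word [] (p1 @ (a, m) # p2) = (F, A1 @ a # A', B1 @ B')"
    if "bump_word (R1 @ [m]) p2 = (F, A', B')" for F A' B'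
    using bump_word_append[OF 1, of "(a, m) # p2"] that by simp
  have "sorted_wrt (<) (map fst p2)" "\<forall>x\<in>set R1 \<union> snd ` set p2. x < m"
    using Row.prems(1,2,5) lt by (auto simp: sorted_wrt_append)
  from bump_word_snoc_max[OF 2 this] consider
    "A2 = []" "bump_word (R1 @ [m]) p2 = (R2 @ [m], [], B2)"
  | b A' C1 C2 where "A2 = b # A'" "B2 = C1 @ C2" "\<forall>v\<in>fst ` set C1. v < b"
      "\<forall>v\<in>fst ` set C2. b < v" "bump_word (R1 @ [m]) p2 = (R2, A', C1 @ (b, m) # C2)"
    by auto
  then show ?case
  proof cases
    case 1
    then have "row_insert a A = (A1 @ [a], None)"
      using row_insert_between[OF A] RAB by simp
    with Row.prems(6) have "P' = (A1 @ [a]) # P" "k = 0" by auto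
    moreover have "bump_word [] (p1 @ (a, m) # p2) = (R @ [m], A1 @ [a], B)"
      using new[OF 1(2)] 1(1) RAB by simp
    ultimately show ?thesis
      using tableaux_of.Row[OF _ _ Row.hyps(3)] by (simp add: add_cell_def)
  next
    case 2
    then have "row_insert a A = (A1 @ a # A', Some b)"
      using row_insert_between[OF A] RAB by simp
    moreover obtain P'' k' where ins: "schensted_insert b P = (P'', k')"
      by (rule prod.exhaust)
    ultimately have P'': "P' = (A1 @ a # A') # P''" "k = Suc k'"
      using Row.prems(6) by simp_all
    have "tableaux_of ((B1 @ C1) @ (b, m) # C2) P'' (add_cell k' m Q)"
    proof (rule Row.IH)
      show "B = (B1 @ C1) @ C2" using RAB 2 by simp
      show "sorted_wrt (<) (map fst B)"
        using bump_word_sorted_fst[OF Row.hyps(2) Row.prems(2)] .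
      have "a < b" using A 2 by simp
      moreover have "\<forall>v\<in>fst ` set B1. v < a"
        using subsetD[OF sets(2)] Row.prems(3) by blast
      ultimately have "\<forall>v\<in>fst ` set B1. v < b" by fastforce
      then show "\<forall>v\<in>fst ` set (B1 @ C1). v < b"
        using 2(3) by auto
      have "snd ` set B \<subseteq> snd ` set p" using bump_word_sets[OF Row.hyps(2)] by simp
      with Row.prems(5) show "\<forall>x\<in>snd ` set B. x < m" by blast
    qed (use 2 ins in auto)
    moreover have "bump_word [] (p1 @ (a, m) # p2) = (R, A1 @ a # A', (B1 @ C1) @ (b, m) # C2)"
      using new[OF 2(5)] 2(2) RAB by simp
    moreover have "add_cell k m (R # Q) = R # add_cell k' m Q"
      using P''(2) by (simp add: add_cell_def)
    ultimately show ?thesis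
      using P''(1) tableaux_of.Row[of "p1 @ (a, m) # p2"] by simp
  qed
qed

lemma sorted_filter_append:
  "sorted_wrt (<) (map f p) \<Longrightarrow> filter (\<lambda>y. f y < a) p @ filter (\<lambda>y. \<not> f y < a) p = p"
  for f :: "'a \<Rightarrow> 'b::linorder"
proof (induction p)
  case (Cons u p)
  show ?case
  proof (cases "f u < a")
    case False
    with Cons.prems have "\<forall>y\<in>set p. \<not> f y < a" by fastforce
    with False show ?thesis by (simp add: filter_id_conv filter_empty_conv)
  qed (use Cons in simp)
qed simp

text \<open>The pairs \<open>(value, time)\<close> of the letters read so far, ordered by value, spell the inverse
  of the prefix read; their tableaux are those of the prefix.\<close>

lemma RS_aux_tableaux_of:
  assumes "tableaux_of p P Q" and "sorted_wrt (<) (map fst p)" and "\<forall>x\<in>snd ` set p. x < i"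
    and "distinct xs" and "fst ` set p \<inter> set xs = {}" and "RS_aux i xs (P, Q) = (P', Q')"
  shows "\<exists>p'. tableaux_of p' P' Q' \<and> sorted_wrt (<) (map fst p') \<and>
    set p' = set p \<union> set (zip xs [i..<i + length xs])"
  using assms
proof (induction xs arbitrary: i p P Q)
  case (Cons a xs)
  obtain P1 k where ins: "schensted_insert a P = (P1, k)" by fastforce
  define p1 where "p1 = filter (\<lambda>y. fst y < a) p"
  define p2 where "p2 = filter (\<lambda>y. \<not> fst y < a) p"
  have p: "p = p1 @ p2"
    unfolding p1_def p2_def using sorted_filter_append[OF Cons.prems(2)] by simp
  have lt: "\<forall>v\<in>fst ` set p1. v < a" "\<forall>v\<in>fst ` set p2. a < v"
    using Cons.prems(5) by (force simp: p1_def p2_def)+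
  let ?p = "p1 @ (a, i) # p2"
  have "\<exists>p'. tableaux_of p' P' Q' \<and> sorted_wrt (<) (map fst p') \<and>
    set p' = set ?p \<union> set (zip xs [Suc i..<Suc i + length xs])"
  proof (rule Cons.IH)
    show "tableaux_of ?p P1 (add_cell k i Q)"
      using tableaux_of_insert[OF Cons.prems(1) p Cons.prems(2) lt Cons.prems(3) ins] .
    show "sorted_wrt (<) (map fst ?p)"
      using Cons.prems(2) lt p by (fastforce simp: sorted_wrt_append)
    show "\<forall>x\<in>snd ` set ?p. x < Suc i" using Cons.prems(3) p by (auto intro: less_SucI)
    show "distinct xs" using Cons.prems(4) by simp
    show "fst ` set ?p \<inter> set xs = {}" using Cons.prems(4,5) p by auto
    show "RS_aux (Suc i) xs (P1, add_cell k i Q) = (P', Q')"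
      using Cons.prems(6) ins by simp
  qed
  moreover have "set ?p \<union> set (zip xs [Suc i..<Suc i + length xs]) =
      set p \<union> set (zip (a # xs) [i..<i + length (a # xs)])"
    using p by (auto simp: upt_conv_Cons simp del: upt_Suc)
  ultimately show ?case by simp
qed auto

lemma inv_word_knuth_recording_tableau:
  assumes "w permutes {1..n}"
  shows "map (inv w) [1..<n+1] \<approx> concat (rev (recording_tableau n w))"
proof -
  let ?xs = "map w [1..<n+1]"
  obtain P Q where PQ: "RS_aux 1 ?xs ([], []) = (P, Q)" by fastforce
  have inj: "inj w" using assms permutes_inj by blast
  have dist: "distinct ?xs"
    using inj by (auto simp: distinct_map inj_on_def dest: injD simp del: upt_Suc)
  obtain p where p: "tableaux_of p P Q" "sorted_wrt (<) (map fst p)"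
      "set p = set (zip ?xs [1..<1 + length ?xs])"
    using RS_aux_tableaux_of[OF tableaux_of.Nil _ _ dist _ PQ] by auto
  have "set (zip ?xs [1..<1 + length ?xs]) = (\<lambda>i. (w i, i)) ` {1..n}"
    by (auto simp: zip_map1 zip_same_conv_map atLeastLessThanSuc_atLeastAtMost simp del: upt_Suc)
  with p have set_p: "set p = (\<lambda>i. (w i, i)) ` {1..n}" by simp
  then have "fst ` set p = {1..n}"
    using permutes_image[OF assms] by (simp add: image_image)
  then have "map fst p = [1..<n+1]"
    using p(2) by (intro sorted_distinct_set_unique)
      (auto simp: strict_sorted_iff atLeastLessThanSuc_atLeastAtMost simp del: upt_Suc)
  moreover have "map snd p = map (inv w) (map fst p)"
    using set_p inj by (auto simp: inv_f_f)
  ultimately have snd: "map snd p = map (inv w) [1..<n+1]" by simp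
  have "inj (inv w)" using assms permutes_inj permutes_inv by blast
  then have "distinct (map snd p)"
    unfolding snd by (auto simp: distinct_map inj_on_def dest: injD simp del: upt_Suc)
  with tableaux_of_knuth_equiv[OF p(1)] snd PQ show ?thesis
    by (simp add: recording_tableau_def RS_def del: upt_Suc)
qed


section \<open>A box-ball move as a row insertion\<close>

definition next_box :: "int set \<Rightarrow> int \<Rightarrow> int" where
  "next_box E p = (LEAST k. p < k \<and> k \<in> E)"

abbreviation unbounded :: "int set \<Rightarrow> bool" where
  "unbounded E \<equiv> \<forall>k. \<exists>l\<in>E. k < l"

text \<open>Insertion of a word into a row without a last entry, so that every letter bumps: \<open>vacate\<close>
  is the resulting row and \<open>land\<close> the word of bumped letters.\<close>

fun vacate :: "int set \<Rightarrow> int list \<Rightarrow> int set" where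
  "vacate E [] = E"
| "vacate E (p # ps) = vacate (insert p (E - {next_box E p})) ps"

fun land :: "int set \<Rightarrow> int list \<Rightarrow> int list" where
  "land E [] = []"
| "land E (p # ps) = next_box E p # land (insert p (E - {next_box E p})) ps"

lemma next_box_eqI:
  assumes "q \<in> E" "p < q" "\<And>k. k \<in> E \<Longrightarrow> p < k \<Longrightarrow> q \<le> k"
  shows "next_box E p = q"
  unfolding next_box_def using assms by (intro Least_equality) auto

lemma next_box:
  assumes "unbounded E"
  shows "next_box E p \<in> E" "p < next_box E p" "k \<in> E \<Longrightarrow> p < k \<Longrightarrow> next_box E p \<le> k"
proof -
  obtain l where l: "l \<in> E" "p < l" using assms by blast
  define q where "q = Min (E \<inter> {p<..l})"
  have fin: "finite (E \<inter> {p<..l})" by simp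
  have "q \<in> E \<inter> {p<..l}" unfolding q_def using l fin by (intro Min_in) auto
  moreover have "q \<le> k" if "k \<in> E" "p < k" for k
  proof (cases "k \<le> l")
    case True
    with that show ?thesis unfolding q_def by (intro Min_le[OF fin]) auto
  next
    case False
    with \<open>q \<in> E \<inter> {p<..l}\<close> show ?thesis by auto
  qed
  ultimately have q: "q \<in> E" "p < q" "\<And>k. k \<in> E \<Longrightarrow> p < k \<Longrightarrow> q \<le> k" by auto
  then have "next_box E p = q" by (intro next_box_eqI)
  with q show "next_box E p \<in> E" "p < next_box E p" "k \<in> E \<Longrightarrow> p < k \<Longrightarrow> next_box E p \<le> k"
    by auto
qed

lemma unbounded_exchange: "unbounded E \<Longrightarrow> unbounded (insert p (E - {q}))"
proof
  fix k assume "unbounded E"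
  then obtain l where "l \<in> E" "max k q < l" by blast
  then show "\<exists>l\<in>insert p (E - {q}). k < l" by (intro bexI[of _ l]) auto
qed

lemma unbounded_vacate: "unbounded E \<Longrightarrow> unbounded (vacate E ps)"
proof (induction ps arbitrary: E)
  case (Cons p ps)
  show ?case using Cons.IH[OF unbounded_exchange[OF Cons.prems]] by simp
qed simp

lemma vacate_subset: "vacate E ps \<subseteq> E \<union> set ps"
proof (induction ps arbitrary: E)
  case (Cons p ps)
  show ?case using Cons.IH[of "insert p (E - {next_box E p})"] by auto
qed simp

lemma land_append: "land E (a @ b) = land E a @ land (vacate E a) b"
  by (induction a arbitrary: E) auto

text \<open>After \<open>y\<close> has bumped \<open>q\<close>, the box \<open>y\<close> belongs to the row and separates \<open>x\<close> from \<open>z\<close>. So the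
  box \<open>s\<close> bumped by \<open>x\<close> and the box \<open>r\<close> bumped by \<open>z\<close> do not depend on their order, and
  \<open>s \<le> y < q < r\<close> makes the exchange a Knuth move.\<close>

lemma land_yzx:
  assumes E: "unbounded E" and xyz: "x < y" "y < z" and notin: "x \<notin> E" "y \<notin> E" "z \<notin> E"
  shows "vacate E [y, z, x] = vacate E [y, x, z] \<and> land E [y, z, x] \<approx> land E [y, x, z]"
proof -
  define q where "q = next_box E y"
  define F where "F = insert y (E - {q})"
  define r where "r = next_box F z"
  define s where "s = next_box F x"
  note q = next_box[OF E, where p = y, folded q_def]
  have F: "unbounded F" unfolding F_def by (rule unbounded_exchange[OF E])
  note r = next_box[OF F, where p = z, folded r_def]
  note s = next_box[OF F, where p = x, folded s_def]
  have "s \<le> y" using s(3)[of y] xyz by (simp add: F_def)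
  have "r \<in> E" "r \<noteq> q" using r xyz by (auto simp: F_def)
  then have "q < r" using q(3)[of r] r xyz by simp
  have s': "next_box (insert z (F - {r})) x = s"
    using s r xyz \<open>s \<le> y\<close> by (intro next_box_eqI) auto
  have r': "next_box (insert x (F - {s})) z = r"
    using s r xyz \<open>s \<le> y\<close> by (intro next_box_eqI) auto
  have "land E [y, z, x] = [q, r, s]" "land E [y, x, z] = [q, s, r]"
    using s' r' by (simp_all flip: q_def F_def r_def s_def)
  moreover have "[] @ [q, r, s] @ [] \<approx> [] @ [q, s, r] @ []"
    using \<open>s \<le> y\<close> q \<open>q < r\<close> by (intro knuth_equiv.yzx) auto
  moreover have "vacate E [y, z, x] = insert x (insert z (F - {r}) - {s})"
    "vacate E [y, x, z] = insert z (insert x (F - {s}) - {r})"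
    using s' r' by (simp_all flip: q_def F_def r_def s_def)
  moreover have "s \<noteq> z" "x \<noteq> r" using \<open>s \<le> y\<close> xyz r by auto
  ultimately show ?thesis by auto
qed

text \<open>If some box of \<open>E\<close> lies between \<open>x\<close> and \<open>z\<close>, the letters \<open>x\<close> and \<open>z\<close> bump the same boxes
  in either order. Otherwise whichever comes first bumps the same box \<open>q\<close>, the first one after
  \<open>z\<close>; the box \<open>z\<close>, once free, goes to \<open>y\<close> or to \<open>x\<close>, and the remaining letter takes the next
  box after \<open>q\<close>. The bumped words then differ by a Knuth move of the other kind.\<close>

lemma land_xzy:
  assumes E: "unbounded E" and xyz: "x < y" "y < z" and notin: "x \<notin> E" "y \<notin> E" "z \<notin> E"
  shows "vacate E [x, z, y] = vacate E [z, x, y] \<and> land E [x, z, y] \<approx> land E [z, x, y]"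
proof -
  define q where "q = next_box E x"
  define F where "F = insert x (E - {q})"
  define r where "r = next_box F z"
  define G where "G = insert z (F - {r})"
  define s where "s = next_box G y"
  note q = next_box[OF E, where p = x, folded q_def]
  have F: "unbounded F" unfolding F_def by (rule unbounded_exchange[OF E])
  note r = next_box[OF F, where p = z, folded r_def]
  have G: "unbounded G" unfolding G_def by (rule unbounded_exchange[OF F])
  note s = next_box[OF G, where p = y, folded s_def]
  have left: "land E [x, z, y] = [q, r, s]" "vacate E [x, z, y] = insert y (G - {s})"
    by (simp_all flip: q_def F_def r_def G_def s_def)
  have "s \<le> z" using s(3)[of z] xyz by (simp add: G_def)
  have "q \<noteq> z" using q notin by auto
  then consider "q < z" | "z < q" by linarith
  then show ?thesis
  proof cases
    case 1
    have r': "next_box E z = r"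
      using r xyz 1 by (intro next_box_eqI) (auto simp: F_def)
    have q': "next_box (insert z (E - {r})) x = q"
      using q r 1 by (intro next_box_eqI) auto
    have G': "insert x (insert z (E - {r}) - {q}) = G"
      using 1 r xyz by (auto simp: G_def F_def)
    have right: "land E [z, x, y] = [r, q, s]" "vacate E [z, x, y] = insert y (G - {s})"
      by (simp_all add: r' q' G' flip: s_def)
    have "q < s"
    proof (cases "s = z")
      case False
      then have "s \<in> E" "s \<noteq> q" using s xyz by (auto simp: G_def F_def)
      with q(3)[of s] s xyz show ?thesis by simp
    qed (use 1 in simp)
    then have "[] @ [q, r, s] @ [] \<approx> [] @ [r, q, s] @ []"
      using \<open>s \<le> z\<close> r by (intro knuth_equiv.xzy) auto
    then show ?thesis unfolding left right by simp
  next
    case 2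
    have q': "next_box E z = q"
      using q 2 xyz by (intro next_box_eqI) auto
    have z': "next_box (insert z (E - {q})) x = z"
      using q 2 xyz by (intro next_box_eqI) force+
    have F': "insert x (insert z (E - {q}) - {z}) = F"
      using notin 2 xyz by (auto simp: F_def)
    have "r \<in> E" "r \<noteq> q" using r xyz by (auto simp: F_def)
    then have "q < r" using q(3)[of r] r xyz by simp
    have r': "next_box F y = r"
    proof (rule next_box_eqI)
      fix k assume "k \<in> F" "y < k"
      then have "k \<in> E" "q \<le> k" using q(3)[of k] xyz by (auto simp: F_def)
      then show "r \<le> k" using r(3)[of k] \<open>k \<in> F\<close> 2 by simp
    qed (use r xyz in auto)
    have s': "s = z"
    proof -
      have "z \<le> s" if "s \<noteq> z"
        using that q(3)[of s] s xyz 2 by (auto simp: G_def F_def)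
      with \<open>s \<le> z\<close> show ?thesis by auto
    qed
    have "land E [z, x, y] = [q, z, r]" "vacate E [z, x, y] = insert y (F - {r})"
      by (simp_all only: vacate.simps land.simps q' z' F' r')
    moreover have "z \<notin> F" using notin xyz by (auto simp: F_def)
    moreover have "[] @ [q, r, z] @ [] \<approx> [] @ [q, z, r] @ []"
      using 2 \<open>q < r\<close> by (intro knuth_equiv.yzx) auto
    ultimately show ?thesis using left s' by (auto simp: G_def)
  qed
qed

text \<open>Bumping out of a row preserves Knuth equivalence: the three letters of a move bump three
  letters that are again related by a move and leave the same row behind.\<close>

lemma land_knuth_equiv:
  "u \<approx> v \<Longrightarrow> unbounded E \<Longrightarrow> distinct u \<Longrightarrow> set u \<inter> E = {} \<Longrightarrow> land E u \<approx> land E v"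
proof (induction rule: knuth_equiv.induct)
  case (sym u v)
  then show ?case
    using knuth_equiv_set[OF sym.hyps] knuth_equiv_distinct[OF sym.hyps]
    by (auto intro: knuth_equiv.sym)
next
  case (trans u v w)
  then show ?case
    using knuth_equiv_set[OF trans.hyps(1)] knuth_equiv_distinct[OF trans.hyps(1)]
    by (metis knuth_equiv.trans)
next
  case (yzx x y z a b)
  have "unbounded (vacate E a)" using yzx by (simp add: unbounded_vacate)
  moreover have "x \<notin> vacate E a" "y \<notin> vacate E a" "z \<notin> vacate E a"
    using yzx vacate_subset[of E a] by auto
  ultimately have *: "vacate (vacate E a) [y, z, x] = vacate (vacate E a) [y, x, z]"
      "land (vacate E a) [y, z, x] \<approx> land (vacate E a) [y, x, z]"
    using land_yzx[OF _ yzx.hyps] by blast+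
  show ?case
    unfolding land_append *(1) by (rule knuth_equiv_context[OF *(2)])
next
  case (xzy x y z a b)
  have "unbounded (vacate E a)" using xzy by (simp add: unbounded_vacate)
  moreover have "x \<notin> vacate E a" "y \<notin> vacate E a" "z \<notin> vacate E a"
    using xzy vacate_subset[of E a] by auto
  ultimately have *: "vacate (vacate E a) [x, z, y] = vacate (vacate E a) [z, x, y]"
      "land (vacate E a) [x, z, y] \<approx> land (vacate E a) [z, x, y]"
    using land_xzy[OF _ xzy.hyps] by blast+
  show ?case
    unfolding land_append *(1) by (rule knuth_equiv_context[OF *(2)])
qed (rule knuth_equiv.refl)

definition ball_pos :: "(int \<Rightarrow> nat) \<Rightarrow> nat \<Rightarrow> int" where
  "ball_pos X i = (THE k. X k = i)"

definition position_word :: "nat \<Rightarrow> (int \<Rightarrow> nat) \<Rightarrow> int list" where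
  "position_word n X = map (ball_pos X) [1..<n+1]"

lemma ball_pos_eq_iff:
  assumes "is_config n X" "i \<in> {1..n}"
  shows "ball_pos X i = k \<longleftrightarrow> X k = i"
proof -
  have ex1: "\<exists>!k. X k = i" using assms by (simp add: is_config_def)
  have "X (ball_pos X i) = i" unfolding ball_pos_def by (rule theI'[OF ex1])
  with ex1 show ?thesis by auto
qed

lemma ball_at_ball_pos: "is_config n X \<Longrightarrow> i \<in> {1..n} \<Longrightarrow> X (ball_pos X i) = i"
  using ball_pos_eq_iff by blast

lemma config_range: "is_config n X \<Longrightarrow> X k \<in> {1..n} \<or> X k = empty_box n"
  by (auto simp: is_config_def)

lemma set_position_word:
  assumes "is_config n X"
  shows "set (position_word n X) = nonempty_boxes n X"
proof -
  have "nonempty_boxes n X = ball_pos X ` {1..n}"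
  proof (intro equalityI subsetI)
    fix k assume "k \<in> nonempty_boxes n X"
    then have "X k \<in> {1..n}" using config_range[OF assms, of k] by (simp add: nonempty_boxes_def)
    moreover from this have "k = ball_pos X (X k)" using ball_pos_eq_iff[OF assms] by metis
    ultimately show "k \<in> ball_pos X ` {1..n}" by (rule rev_image_eqI)
  next
    fix k assume "k \<in> ball_pos X ` {1..n}"
    then obtain i where "i \<in> {1..n}" "k = ball_pos X i" by (rule imageE)
    then show "k \<in> nonempty_boxes n X"
      using ball_at_ball_pos[OF assms] by (simp add: nonempty_boxes_def)
  qed
  then show ?thesis
    by (simp add: position_word_def atLeastLessThanSuc_atLeastAtMost del: upt_Suc)
qed

lemma unbounded_empty_boxes:
  assumes "is_config n X"
  shows "unbounded (- nonempty_boxes n X)"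
proof
  fix k
  have "finite (nonempty_boxes n X)"
    unfolding set_position_word[OF assms, symmetric] by (rule List.finite_set)
  then have "infinite ({k<..} - nonempty_boxes n X)"
    by (rule Diff_infinite_finite) (rule infinite_Ioi)
  then have "{k<..} - nonempty_boxes n X \<noteq> {}" by (metis finite.emptyI)
  then show "\<exists>l\<in>- nonempty_boxes n X. k < l" by auto
qed

lemma distinct_position_word:
  assumes "is_config n X"
  shows "distinct (position_word n X)"
proof -
  have "inj_on (ball_pos X) {1..n}"
    by (rule inj_on_inverseI[where g = X]) (rule ball_at_ball_pos[OF assms])
  then show ?thesis
    by (simp add: position_word_def distinct_map atLeastLessThanSuc_atLeastAtMost del: upt_Suc)
qed

lemma jump_config:
  assumes X: "is_config n X" and i: "i \<in> {1..n}"
  defines "E \<equiv> - nonempty_boxes n X"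
  defines "q \<equiv> next_box E (ball_pos X i)"
  shows "is_config n (jump n i X)"
    and "- nonempty_boxes n (jump n i X) = insert (ball_pos X i) (E - {q})"
    and "\<And>j. j \<in> {1..n} \<Longrightarrow> ball_pos (jump n i X) j = (if j = i then q else ball_pos X j)"
proof -
  let ?p = "ball_pos X i"
  note q = next_box[OF unbounded_empty_boxes[OF X], where p = ?p, folded E_def, folded q_def]
  have jump: "jump n i X = X(?p := empty_box n, q := i)"
    by (simp add: jump_def Let_def q_def next_box_def E_def nonempty_boxes_def
        flip: ball_pos_def)
  have p: "X ?p = i" by (rule ball_at_ball_pos[OF X i])
  have Xq: "X q = empty_box n" using q(1) by (simp add: E_def nonempty_boxes_def)
  have iff: "jump n i X k = j \<longleftrightarrow> k = (if j = i then q else ball_pos X j)"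
    if j: "j \<in> {1..n}" for j k
    using j p Xq i ball_pos_eq_iff[OF X j, of k] ball_pos_eq_iff[OF X i, of k] q(2)
    by (auto simp: jump)
  show config: "is_config n (jump n i X)"
    unfolding is_config_def
  proof (intro conjI ballI allI impI)
    fix j assume "j \<in> {1..n}"
    then show "\<exists>!k. jump n i X k = j" using iff by simp
  next
    fix k assume "jump n i X k \<notin> {1..n}"
    then show "jump n i X k = empty_box n"
      using config_range[OF X, of k] i by (auto simp: jump split: if_splits)
  qed
  show "- nonempty_boxes n (jump n i X) = insert ?p (E - {q})"
    using q(2) i by (auto simp: jump E_def nonempty_boxes_def)
  show "ball_pos (jump n i X) j = (if j = i then q else ball_pos X j)" if "j \<in> {1..n}" for j
    using ball_pos_eq_iff[OF config that] iff[OF that] by blast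
qed

lemma fold_jump:
  assumes "is_config n X" and "distinct js" and "set js \<subseteq> {1..n}"
  shows "is_config n (fold (jump n) js X) \<and>
    (\<forall>j\<in>{1..n} - set js. ball_pos (fold (jump n) js X) j = ball_pos X j) \<and>
    map (ball_pos (fold (jump n) js X)) js = land (- nonempty_boxes n X) (map (ball_pos X) js)"
  using assms
proof (induction js arbitrary: X)
  case (Cons i js)
  then have i: "i \<in> {1..n}" "i \<notin> set js" by auto
  note jump = jump_config[OF Cons.prems(1) i(1)]
  have eq: "map (ball_pos (jump n i X)) js = map (ball_pos X) js"
    using jump(3) Cons.prems(3) i(2) by (auto intro!: map_cong)
  have IH: "is_config n (fold (jump n) js (jump n i X))"
    "\<forall>j\<in>{1..n} - set js. ball_pos (fold (jump n) js (jump n i X)) j = ball_pos (jump n i X) j"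
    "map (ball_pos (fold (jump n) js (jump n i X))) js =
      land (- nonempty_boxes n (jump n i X)) (map (ball_pos (jump n i X)) js)"
    using Cons.IH[OF jump(1)] Cons.prems by simp_all
  show ?case
    using IH i by (simp add: jump(2,3) eq)
qed simp

text \<open>The balls jump in the order of the position word, and each exchanges its box with the
  nearest empty box to its right: a box-ball move inserts the position word into the row of
  empty boxes, and the bumped letters are the new positions.\<close>

lemma position_word_BB:
  assumes "is_config n X"
  shows "is_config n (BB n X)"
    and "position_word n (BB n X) = land (- nonempty_boxes n X) (position_word n X)"
  using fold_jump[OF assms, of "[1..<n+1]"]
  by (simp_all add: BB_def position_word_def atLeastLessThanSuc_atLeastAtMost del: upt_Suc)

lemma position_word_BB_knuth_equiv:
  assumes "is_config n X" "is_config n Y" "position_word n X \<approx> position_word n Y"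
  shows "position_word n (BB n X) \<approx> position_word n (BB n Y)"
proof -
  have "nonempty_boxes n X = nonempty_boxes n Y"
    using knuth_equiv_set[OF assms(3)] set_position_word assms(1,2) by metis
  moreover have "land (- nonempty_boxes n X) (position_word n X) \<approx>
      land (- nonempty_boxes n X) (position_word n Y)"
    using assms set_position_word[OF assms(1)]
    by (intro land_knuth_equiv unbounded_empty_boxes distinct_position_word) auto
  ultimately show ?thesis by (simp add: position_word_BB assms)
qed


section \<open>The shape of the configuration array\<close>

text \<open>The position word records whether \<open>k\<close> is a descent of the configuration in the order of
  its letters \<open>k\<close> and \<open>k + 1\<close>.\<close>

lemma filter_position_word:
  assumes X: "is_config n X" and k: "k \<in> nonempty_boxes n X" "k + 1 \<in> nonempty_boxes n X"
  shows "filter (\<lambda>j. j = k \<or> j = k + 1) (position_word n X) =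
    (if X k < X (k + 1) then [k, k + 1] else [k + 1, k])"
proof -
  let ?f = "filter (\<lambda>i. i = X k \<or> i = X (k + 1)) [1..<n+1]"
  have r: "X k \<in> {1..n}" "X (k + 1) \<in> {1..n}"
    using k config_range[OF X] by (auto simp: nonempty_boxes_def)
  have pos: "ball_pos X (X k) = k" "ball_pos X (X (k + 1)) = k + 1"
    by (simp_all only: ball_pos_eq_iff[OF X] r)
  then have ne: "X k \<noteq> X (k + 1)" by auto
  have "filter (\<lambda>j. j = k \<or> j = k + 1) (position_word n X) = map (ball_pos X) ?f"
    unfolding position_word_def filter_map
    by (rule arg_cong[where f = "map (ball_pos X)"], rule filter_cong)
      (simp_all add: ball_pos_eq_iff[OF X] eq_commute[of "X _"] del: upt_Suc)
  moreover have "?f = (if X k < X (k + 1) then [X k, X (k + 1)] else [X (k + 1), X k])"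
  proof (rule sorted_distinct_set_unique)
    show "set ?f = set (if X k < X (k + 1) then [X k, X (k + 1)] else [X (k + 1), X k])"
      using r by (auto simp del: upt_Suc)
  qed (use ne in \<open>simp_all add: sorted_wrt_filter del: upt_Suc\<close>)
  ultimately show ?thesis using pos by simp
qed

lemma increasing_block_iff:
  "increasing_block n X a b \<longleftrightarrow>
    a \<le> b \<and> {a..b} \<subseteq> nonempty_boxes n X \<and> (\<forall>k. a \<le> k \<and> k < b \<longrightarrow> X k < X (k + 1))"
proof -
  have "strict_mono_on {a..b} X" if step: "\<forall>k. a \<le> k \<and> k < b \<longrightarrow> X k < X (k + 1)"
  proof (rule strict_mono_onI)
    fix r s assume rs: "r \<in> {a..b}" "s \<in> {a..b}" "r < s"
    have "s \<le> b \<longrightarrow> X r < X s"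
      using \<open>r < s\<close>
    proof (induction s rule: int_gr_induct)
      case base
      then show ?case using step[rule_format, of r] rs by simp
    next
      case (step s)
      show ?case
      proof
        assume "s + 1 \<le> b"
        then have "X r < X s" "X s < X (s + 1)"
          using step that[rule_format, of s] rs by simp_all
        then show "X r < X (s + 1)" by (rule less_trans)
      qed
    qed
    with rs show "X r < X s" by simp
  qed
  moreover have "X k < X (k + 1)" if "strict_mono_on {a..b} X" "a \<le> k" "k < b" for k
    using strict_mono_onD[OF that(1), of k "k + 1"] that(2,3) by simp
  ultimately have "strict_mono_on {a..b} X \<longleftrightarrow> (\<forall>k. a \<le> k \<and> k < b \<longrightarrow> X k < X (k + 1))"
    by blast
  then show ?thesis
    by (simp add: increasing_block_def nonempty_boxes_def subset_eq)
qed

lemma runs_cong: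
  assumes X: "is_config n X" and Y: "is_config n Y"
    and eq: "position_word n X \<approx> position_word n Y"
  shows "runs n X = runs n Y"
proof -
  have ne: "nonempty_boxes n X = nonempty_boxes n Y"
    using knuth_equiv_set[OF eq] set_position_word X Y by metis
  have "X k < X (k + 1) \<longleftrightarrow> Y k < Y (k + 1)"
    if k: "k \<in> nonempty_boxes n X" "k + 1 \<in> nonempty_boxes n X" for k
    using filter_position_word[OF X k] filter_position_word[OF Y k[unfolded ne]]
      knuth_equiv_filter_consecutive[OF eq, of k]
    by (auto split: if_splits)
  then have "increasing_block n X a b \<longleftrightarrow> increasing_block n Y a b" for a b
    unfolding increasing_block_iff ne[symmetric] by (auto simp: subset_iff)
  then show ?thesis by (simp add: runs_def increasing_run_def)
qed

lemma CA_shape_eq: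
  "CA_shape (CA n X) = {(i, c). i < length (sh (ID n X)) \<and> CA_start n X i \<le> c \<and>
     c < CA_start n X i + int (sh (ID n X) ! i)}"
  by (auto simp: CA_shape_def CA_def sh_def dom_def split: if_splits)

lemma position_word_perm_config:
  assumes "w permutes {1..n}"
  shows "position_word n (perm_config n w) = map int (map (inv w) [1..<n+1])"
proof -
  have "ball_pos (perm_config n w) i = int (inv w i)" if i: "i \<in> {1..n}" for i
  proof -
    have "inv w i \<in> {1..n}" "w (inv w i) = i"
      using i assms by (simp_all only: permutes_in_image[OF permutes_inv] permutes_inverses)
    then show ?thesis
      using ball_pos_eq_iff[OF is_config_perm_config[OF assms] i]
      by (auto simp: perm_config_def)
  qed
  then show ?thesis
    by (simp add: position_word_def atLeastLessThanSuc_atLeastAtMost del: upt_Suc)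
qed

theorem proposition4p6:
  fixes n :: nat and \<pi> w :: "nat \<Rightarrow> nat"
  assumes "\<pi> permutes {1..n}" and "w permutes {1..n}"
    and "recording_tableau n \<pi> = recording_tableau n w"
  shows "\<forall>t::nat.
    (let X = (BB n ^^ t) (perm_config n \<pi>);
         Y = (BB n ^^ t) (perm_config n w)
     in nonempty_boxes n X = nonempty_boxes n Y \<and>
        (sh (ID n X) = sh (ID n Y) \<and> gaps n X = gaps n Y) \<and>
        CA_shape (CA n X) = CA_shape (CA n Y))"
proof
  fix t :: nat
  define X where "X = (BB n ^^ t) (perm_config n \<pi>)"
  define Y where "Y = (BB n ^^ t) (perm_config n w)"
  have "map (inv \<pi>) [1..<n+1] \<approx> map (inv w) [1..<n+1]"
    using inv_word_knuth_recording_tableau[OF assms(1)] inv_word_knuth_recording_tableau[OF assms(2)]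
    unfolding assms(3) by (blast intro: knuth_equiv.intros)
  then have "position_word n (perm_config n \<pi>) \<approx> position_word n (perm_config n w)"
    unfolding position_word_perm_config[OF assms(1)] position_word_perm_config[OF assms(2)]
    by (intro knuth_equiv_map) (simp_all add: strict_mono_def)
  then have "is_config n X \<and> is_config n Y \<and> position_word n X \<approx> position_word n Y"
    unfolding X_def Y_def
    by (induction t)
      (simp_all add: is_config_perm_config[OF assms(1)] is_config_perm_config[OF assms(2)]
        position_word_BB(1) position_word_BB_knuth_equiv)
  then have X: "is_config n X" and Y: "is_config n Y"
    and eq: "position_word n X \<approx> position_word n Y"
    by auto
  have ne: "nonempty_boxes n X = nonempty_boxes n Y"
    using knuth_equiv_set[OF eq] set_position_word X Y by metis
  then have empty: "X k = empty_box n \<longleftrightarrow> Y k = empty_box n" for k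
    by (auto simp: nonempty_boxes_def)
  have runs: "runs n X = runs n Y" by (rule runs_cong[OF X Y eq])
  have sh: "sh (ID n X) = sh (ID n Y)"
    by (simp add: sh_def ID_def runs case_prod_beta comp_def)
  have gaps: "gaps n X = gaps n Y" by (simp add: gaps_def runs empty del: One_nat_def)
  have "CA_shape (CA n X) = CA_shape (CA n Y)"
    by (simp add: CA_shape_eq sh CA_start_def gaps)
  with ne sh gaps show "let X = (BB n ^^ t) (perm_config n \<pi>);
         Y = (BB n ^^ t) (perm_config n w)
     in nonempty_boxes n X = nonempty_boxes n Y \<and>
        (sh (ID n X) = sh (ID n Y) \<and> gaps n X = gaps n Y) \<and>
        CA_shape (CA n X) = CA_shape (CA n Y)"
    by (simp add: X_def Y_def)
qed

end
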